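(* Let $\mathcal{U}$ be an idempotent ultrafilter in $(\beta\mathbb{N},\oplus)$, let $k\in\mathbb{N}$ and let $n_{1},n_{2},\dots,n_{k+1}$ be natural numbers with $n_{i}\neq n_{i+1}$ for every index $i\leq k$. Then for every set $$A\in n_{1}\mathcal{U}\oplus n_{2}\mathcal{U}\oplus\cdots\oplus n_{k+1}\mathcal{U}$$ there exist $x_{1},\dots,x_{k},y_{1},\dots,y_{k},z_{1},\dots,z_{k}\in A$ such that the following three conditions hold: (1) for every $i\leq k$, $x_{i}<y_{i}$ and $x_{i}<z_{i}$; (2) for every $i\leq k$, $n_{i}(z_{i}-x_{i})=n_{i+1}(y_{i}-x_{i})$; (3) for every $i\leq k-1$, $x_{i+1}=z_{i}$.
   Context: Here $\mathbb{N}=\{1,2,3,\dots\}$, and $\beta\mathbb{N}$ is the set of ultrafilters on $\mathbb{N}$. The operation $\oplus$ is the extension of addition to $\beta\mathbb{N}$ given, for $\mathcal{U},\mathcal{V}\in\beta\mathbb{N}$ and $A\subseteq\mathbb{N}$, by $$A\in\mathcal{U}\oplus\mathcal{V}\iff\{n\in\mathbb{N}\mid\{m\in\mathbb{N}\mid n+m\in A\}\in\mathcal{V}\}\in\mathcal{U};$$ it is associative. An ultrafilter $\mathcal{U}$ is idempotent if $\mathcal{U}\oplus\mathcal{U}=\mathcal{U}$. For $n\in\mathbb{N}$, $n\mathcal{U}$ denotes the ultrafilter $\{A\subseteq\mathbb{N}\mid\{m\in\mathbb{N}\mid nm\in A\}\in\mathcal{U}\}$. *)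

theory Defs
  imports Complex_Main
begin

text \<open>
  An element of \<open>\<beta>\<nat>\<close>, for \<open>\<nat> = {1, 2, 3, \<dots>}\<close>, is encoded as a maximal proper filter on the type
  \<^typ>\<open>nat\<close> that contains \<open>{1..}\<close>; this excludes the principal ultrafilter at \<open>0\<close>. A set \<open>A\<close> of
  positive integers belongs to the ultrafilter iff \<open>eventually (\<lambda>x. x \<in> A) \<U>\<close>.
\<close>

definition betaN :: "nat filter set" where
  "betaN = {\<U>. \<U> \<noteq> bot \<and> \<U> \<le> principal {1..} \<and>
     (\<forall>P. eventually P \<U> \<or> eventually (\<lambda>x. \<not> P x) \<U>)}"

text \<open>See \<open>eventually_oplus\<close>: the predicate passed to \<^const>\<open>Abs_filter\<close> is indeed a filter.\<close>

definition oplus :: "nat filter \<Rightarrow> nat filter \<Rightarrow> nat filter" (infixl "\<oplus>" 65) where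
  "\<U> \<oplus> \<V> = Abs_filter (\<lambda>P. eventually (\<lambda>n. eventually (\<lambda>m. P (n + m)) \<V>) \<U>)"

definition idempotent_uf :: "nat filter \<Rightarrow> bool" where
  "idempotent_uf \<U> \<longleftrightarrow> \<U> \<in> betaN \<and> \<U> \<oplus> \<U> = \<U>"

definition scale_uf :: "nat \<Rightarrow> nat filter \<Rightarrow> nat filter" (infixr "\<odot>" 70) where
  "n \<odot> \<U> = filtermap (\<lambda>m. n * m) \<U>"

lemma eventually_oplus:
  "eventually P (\<U> \<oplus> \<V>) \<longleftrightarrow> eventually (\<lambda>n. eventually (\<lambda>m. P (n + m)) \<V>) \<U>"
  unfolding oplus_def
proof (rule eventually_Abs_filter, rule is_filter.intro)
  fix P Q
  assume "\<forall>\<^sub>F n in \<U>. \<forall>\<^sub>F m in \<V>. P (n + m)" and "\<forall>\<^sub>F n in \<U>. \<forall>\<^sub>F m in \<V>. Q (n + m)"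
  then show "\<forall>\<^sub>F n in \<U>. \<forall>\<^sub>F m in \<V>. P (n + m) \<and> Q (n + m)"
    by eventually_elim (rule eventually_conj)
next
  fix P Q :: "nat \<Rightarrow> bool"
  assume "\<forall>x. P x \<longrightarrow> Q x" and "\<forall>\<^sub>F n in \<U>. \<forall>\<^sub>F m in \<V>. P (n + m)"
  then show "\<forall>\<^sub>F n in \<U>. \<forall>\<^sub>F m in \<V>. Q (n + m)"
    by (auto elim!: eventually_mono)
qed simp

lemma eventually_scale_uf:
  "eventually P (n \<odot> \<U>) \<longleftrightarrow> eventually (\<lambda>m. P (n * m)) \<U>"
  by (simp add: scale_uf_def eventually_filtermap)

lemma oplus_assoc: "(\<U> \<oplus> \<V>) \<oplus> \<W> = \<U> \<oplus> (\<V> \<oplus> \<W>)"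
  by (simp add: filter_eq_iff eventually_oplus add.assoc)

lemma betaN_iff:
  "\<U> \<in> betaN \<longleftrightarrow> eventually (\<lambda>x. 1 \<le> x) \<U> \<and>
     (\<forall>P. eventually (\<lambda>x. \<not> P x) \<U> \<longleftrightarrow> \<not> eventually P \<U>)"
proof -
  have "\<U> = bot" if "eventually P \<U>" "eventually (\<lambda>x. \<not> P x) \<U>" for P
    using eventually_conj[OF that] by (simp add: trivial_limit_def)
  moreover have "\<U> \<noteq> bot" if "\<forall>P. eventually (\<lambda>x. \<not> P x) \<U> \<longleftrightarrow> \<not> eventually P \<U>"
    using that[rule_format, of "\<lambda>_. True"] by (simp add: trivial_limit_def)
  moreover have "\<U> \<le> principal {1..} \<longleftrightarrow> eventually (\<lambda>x. 1 \<le> x) \<U>"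
    by (simp add: le_principal)
  ultimately show ?thesis
    unfolding betaN_def mem_Collect_eq by blast
qed

lemma oplus_in_betaN:
  assumes "\<U> \<in> betaN" "\<V> \<in> betaN"
  shows "\<U> \<oplus> \<V> \<in> betaN"
proof -
  from assms(2) have "eventually (\<lambda>m. 1 \<le> n + m) \<V>" for n
    unfolding betaN_iff by (elim conjE eventually_mono) simp
  with assms show ?thesis
    by (simp add: betaN_iff eventually_oplus)
qed

lemma scale_uf_in_betaN:
  assumes "\<U> \<in> betaN" "1 \<le> n"
  shows "n \<odot> \<U> \<in> betaN"
proof -
  from assms have "eventually (\<lambda>m. 1 \<le> n * m) \<U>"
    unfolding betaN_iff by (elim conjE eventually_mono) simp
  with assms show ?thesis
    by (simp add: betaN_iff eventually_scale_uf)
qed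

end

theory Submission
  imports Defs
begin

text \<open>
  Put \<open>\<W> = n\<^sub>2\<U> \<oplus> \<dots> \<oplus> n\<^bsub>k+1\<^esub>\<U>\<close>. Idempotence gives \<open>n\<^sub>1\<U> \<oplus> n\<^sub>1\<U> = n\<^sub>1\<U>\<close> and
  \<open>n\<^sub>2\<U> \<oplus> \<W> = \<W>\<close>, so one can choose \<open>u\<close> and then \<open>t \<ge> 1\<close> such that for \<open>\<W>\<close>-many \<open>m\<close> the three
  numbers \<open>n\<^sub>1u + m\<close>, \<open>n\<^sub>1u + n\<^sub>1t + m\<close> and \<open>n\<^sub>1u + n\<^sub>2t + m\<close> all lie in \<open>A\<close>. Applying the same choice to
  \<open>\<W>\<close> and the set of these \<open>m\<close>, and iterating, produces a chain in which
  \<open>y\<^sub>i = x\<^sub>i + n\<^sub>it\<^sub>i\<close> and \<open>z\<^sub>i = x\<^bsub>i+1\<^esub> = x\<^sub>i + n\<^bsub>i+1\<^esub>t\<^sub>i\<close>.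
\<close>

text \<open>The sum is nested to the left, whereas the induction on the chain strips its first
  summand; associativity reconciles the two.\<close>

lemma foldl_oplus_shift: "foldl (\<oplus>) (\<V> \<oplus> \<W>) ws = \<V> \<oplus> foldl (\<oplus>) \<W> ws"
  by (induction ws arbitrary: \<W>) (simp_all add: oplus_assoc)

lemma scale_uf_oplus: "n \<odot> (\<U> \<oplus> \<V>) = (n \<odot> \<U>) \<oplus> (n \<odot> \<V>)"
  by (simp add: filter_eq_iff eventually_oplus eventually_scale_uf distrib_left)

lemma scale_uf_idem:
  assumes "idempotent_uf \<U>"
  shows "(n \<odot> \<U>) \<oplus> (n \<odot> \<U>) = n \<odot> \<U>"
  using assms by (simp add: idempotent_uf_def flip: scale_uf_oplus)

lemma eventually_scale_shift:
  assumes "(n \<odot> \<U>) \<oplus> \<W> = \<W>" and "eventually P \<W>"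
  shows "eventually (\<lambda>t. eventually (\<lambda>m. P (n * t + m)) \<W>) \<U>"
proof -
  have "eventually P ((n \<odot> \<U>) \<oplus> \<W>)"
    using assms by simp
  then show ?thesis
    by (simp add: eventually_oplus eventually_scale_uf)
qed

text \<open>One link of the chain: with \<open>x = a * u + m\<close>, the other two points are
  \<open>x + a * t\<close> and \<open>x + b * t\<close>. The same \<open>t\<close> serves both,
  since each condition on \<open>t\<close> holds on a set in \<open>\<U>\<close> once
  \<open>u\<close> is fixed.\<close>

lemma oplus_scale_step:
  assumes idem: "idempotent_uf \<U>"
    and absorb: "(b \<odot> \<U>) \<oplus> \<W> = \<W>"
    and A: "eventually (\<lambda>x. x \<in> A) ((a \<odot> \<U>) \<oplus> \<W>)"
  obtains u t where "1 \<le> t"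
    "eventually (\<lambda>m. a * u + m \<in> A \<and> a * u + a * t + m \<in> A \<and> a * u + b * t + m \<in> A) \<W>"
proof -
  from idem have nb: "\<U> \<noteq> bot" and pos: "eventually (\<lambda>t. 1 \<le> t) \<U>"
    by (simp add: idempotent_uf_def betaN_def) (use idem in \<open>simp add: idempotent_uf_def betaN_iff\<close>)
  \<comment> \<open>Doubling the first summand makes room for the extra term \<open>a * t\<close>
    after \<open>a * u\<close>.\<close>
  have "(a \<odot> \<U>) \<oplus> ((a \<odot> \<U>) \<oplus> \<W>) = (a \<odot> \<U>) \<oplus> \<W>"
    by (simp add: scale_uf_idem[OF idem] flip: oplus_assoc)
  from eventually_scale_shift[OF this A]
  have "eventually (\<lambda>u. eventually (\<lambda>t. eventually (\<lambda>m. a * u + (a * t + m) \<in> A) \<W>) \<U>) \<U>"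
    by (simp add: eventually_oplus eventually_scale_uf)
  moreover have "eventually (\<lambda>u. eventually (\<lambda>m. a * u + m \<in> A) \<W>) \<U>"
    using A by (simp add: eventually_oplus eventually_scale_uf)
  ultimately obtain u
    where 1: "eventually (\<lambda>t. eventually (\<lambda>m. a * u + (a * t + m) \<in> A) \<W>) \<U>"
      and 2: "eventually (\<lambda>m. a * u + m \<in> A) \<W>"
    using eventually_happens'[OF nb eventually_conj] by blast
  from eventually_happens'[OF nb eventually_conj[OF pos eventually_conj[OF 1
        eventually_scale_shift[OF absorb 2]]]]
  obtain t where "1 \<le> t" and 3: "eventually (\<lambda>m. a * u + (a * t + m) \<in> A) \<W>"
      "eventually (\<lambda>m. a * u + (b * t + m) \<in> A) \<W>"
    by blast
  then show thesis
    using that[of t u] 2 by (simp add: eventually_conj_iff add.assoc)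
qed

text \<open>Taking \<open>x (Suc i)\<close> as the point z of link \<open>i\<close> builds condition
  (3) into the chain. Both \<open>p\<close> and \<open>A\<close> vary in the induction, because the
  tail starts one index later and must lie in a smaller set.\<close>

lemma oplus_scale_chain:
  fixes n :: "nat \<Rightarrow> nat"
  assumes idem: "idempotent_uf \<U>"
    and A: "eventually (\<lambda>a. a \<in> A)
      (foldl (\<oplus>) (n p \<odot> \<U>) (map (\<lambda>i. n i \<odot> \<U>) [Suc p..<Suc p + k]))"
  obtains x t :: "nat \<Rightarrow> nat" where
    "\<And>i. i \<in> {p..p+k} \<Longrightarrow> x i \<in> A"
    "\<And>i. i \<in> {p..<p+k} \<Longrightarrow> 1 \<le> t i \<and> x (Suc i) = x i + n (Suc i) * t i \<and> x i + n i * t i \<in> A"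
  using A
proof (induction k arbitrary: p A thesis)
  case 0
  from idem have "\<U> \<noteq> bot"
    by (simp add: idempotent_uf_def betaN_def)
  with 0(2) obtain u where "n p * u \<in> A"
    using eventually_happens' by (fastforce simp: eventually_scale_uf)
  then show ?case
    using 0(1)[of "\<lambda>_. n p * u"] by simp
next
  case (Suc k)
  define \<W> where "\<W> = foldl (\<oplus>) (n (Suc p) \<odot> \<U>)
    (map (\<lambda>i. n i \<odot> \<U>) [Suc (Suc p)..<Suc (Suc p) + k])"
  have "foldl (\<oplus>) (n p \<odot> \<U>) (map (\<lambda>i. n i \<odot> \<U>) [Suc p..<Suc p + Suc k]) = (n p \<odot> \<U>) \<oplus> \<W>"
    by (subst upt_conv_Cons) (simp_all add: \<W>_def foldl_oplus_shift del: upt_Suc)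
  with Suc.prems(2) have A: "eventually (\<lambda>a. a \<in> A) ((n p \<odot> \<U>) \<oplus> \<W>)"
    by simp
  \<comment> \<open>The first summand of \<open>\<W>\<close> is idempotent, so another copy of it in
    front is absorbed.\<close>
  have "(n (Suc p) \<odot> \<U>) \<oplus> \<W> = \<W>"
    unfolding \<W>_def by (simp only: scale_uf_idem[OF idem] flip: foldl_oplus_shift)
  from oplus_scale_step[OF idem this A] obtain u s where s: "1 \<le> s"
    and ev: "eventually (\<lambda>m. n p * u + m \<in> A \<and> n p * u + n p * s + m \<in> A
      \<and> n p * u + n (Suc p) * s + m \<in> A) \<W>" .
  define C where "C = {m. n p * u + m \<in> A \<and> n p * u + n p * s + m \<in> A
    \<and> n p * u + n (Suc p) * s + m \<in> A}"
  from ev have "eventually (\<lambda>m. m \<in> C) \<W>"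
    by (simp add: C_def)
  then obtain x t where x: "\<And>i. i \<in> {Suc p..Suc p+k} \<Longrightarrow> x i \<in> C"
    and t: "\<And>i. i \<in> {Suc p..<Suc p+k} \<Longrightarrow>
      1 \<le> t i \<and> x (Suc i) = x i + n (Suc i) * t i \<and> x i + n i * t i \<in> C"
    using Suc.IH[of "Suc p" C] unfolding \<W>_def by blast
  \<comment> \<open>The tail is translated as a whole, which keeps its differences. The new first
    point uses the head of the tail as \<open>m\<close>, so that the step to
    \<open>x' (Suc p)\<close> is exactly \<open>n (Suc p) * s\<close>.\<close>
  define x' where "x' = (\<lambda>i. if i = p then n p * u + x (Suc p) else n p * u + n (Suc p) * s + x i)"
  show ?case
  proof (rule Suc.prems(1))
    fix i assume "i \<in> {p..p + Suc k}"
    then show "x' i \<in> A"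
      using x[of "Suc p"] x[of i] by (cases "i = p") (auto simp: x'_def C_def)
  next
    fix i assume i: "i \<in> {p..<p + Suc k}"
    show "1 \<le> (t(p := s)) i \<and> x' (Suc i) = x' i + n (Suc i) * (t(p := s)) i
      \<and> x' i + n i * (t(p := s)) i \<in> A"
    proof (cases "i = p")
      case True
      then show ?thesis
        using s x[of "Suc p"] by (simp add: x'_def C_def ac_simps)
    next
      case False
      with i show ?thesis
        using t[of i] by (simp add: x'_def C_def ac_simps)
    qed
  qed
qed

theorem theorem3p4:
  fixes \<U> :: "nat filter" and k :: nat and n :: "nat \<Rightarrow> nat" and A :: "nat set"
  assumes "idempotent_uf \<U>"
    and "1 \<le> k"
    and "\<forall>i\<in>{1..k+1}. 1 \<le> n i"
    and "\<forall>i\<in>{1..k}. n i \<noteq> n (i+1)"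
    and "A \<subseteq> {1..}"
    and "eventually (\<lambda>a. a \<in> A) (foldl (\<oplus>) (n 1 \<odot> \<U>) (map (\<lambda>i. n i \<odot> \<U>) [2..<k+2]))"
  shows "\<exists>x y z :: nat \<Rightarrow> nat.
    (\<forall>i\<in>{1..k}. x i \<in> A \<and> y i \<in> A \<and> z i \<in> A) \<and>
    (\<forall>i\<in>{1..k}. x i < y i \<and> x i < z i) \<and>
    (\<forall>i\<in>{1..k}. int (n i) * (int (z i) - int (x i)) = int (n (i+1)) * (int (y i) - int (x i))) \<and>
    (\<forall>i\<in>{1..k-1}. x (i+1) = z i)"
proof -
  have "[2..<k+2] = [Suc 1..<Suc 1 + k]"
    by (simp add: numeral_2_eq_2)
  with assms(6) have "eventually (\<lambda>a. a \<in> A)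
      (foldl (\<oplus>) (n 1 \<odot> \<U>) (map (\<lambda>i. n i \<odot> \<U>) [Suc 1..<Suc 1 + k]))"
    by simp
  from oplus_scale_chain[OF assms(1) this] obtain x t :: "nat \<Rightarrow> nat" where
    x: "\<And>i. i \<in> {1..1+k} \<Longrightarrow> x i \<in> A" and
    t: "\<And>i. i \<in> {1..<1+k} \<Longrightarrow> 1 \<le> t i \<and> x (Suc i) = x i + n (Suc i) * t i \<and> x i + n i * t i \<in> A"
    by blast
  have pos: "0 < n i" "0 < n (Suc i)" if "i \<in> {1..k}" for i
    using assms(3) that by (auto simp: Suc_le_eq)
  \<comment> \<open>Both sides of condition (2) equal \<open>n i * n (i+1) * t i\<close>.\<close>
  show ?thesis
  proof (rule exI[of _ x], rule exI[of _ "\<lambda>i. x i + n i * t i"],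
      rule exI[of _ "\<lambda>i. x (Suc i)"], intro conjI ballI)
    fix i assume i: "i \<in> {1..k}"
    then have ti: "1 \<le> t i" "x (Suc i) = x i + n (Suc i) * t i" "x i + n i * t i \<in> A"
      using t[of i] by auto
    show "x i \<in> A" "x (Suc i) \<in> A"
      using x i by auto
    show "x i + n i * t i \<in> A"
      by (fact ti)
    show "x i < x i + n i * t i" "x i < x (Suc i)"
      using ti pos[OF i] by auto
    show "int (n i) * (int (x (Suc i)) - int (x i))
        = int (n (i+1)) * (int (x i + n i * t i) - int (x i))"
      using ti(2) by simp
  qed simp
qed

end
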